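(* Let $K=uT^3+T$ and consider the operator equation \[ K_{,t}+A^\dagger K+KA=0 . \] (1) Under the choice \[ A=-fT^2+f_{-2}u_{-2}-f_{-1}u_{-1}+f_{-3}T^{-2}, \] this equation (with $t=t_1$) is equivalent to the nonlocal lattice equation \[ u_{,t_1}=u(f_2u_2-f_1u_1+f_{-1}u_{-1}-f_{-2}u_{-2})+f_1-f_{-1},\qquad f_3u=f_{-1}u_2 . \] (2) Under the choice \[ A=u_1T^4-u_{-4}T^{-4}+(1-u_{-1}u_{-2})(T^2-T^{-2})+u_{-1}-u_{-2}-v+v_{-1}-v_{-2}+v_{-3},\qquad v:=u_1uu_{-1}, \] this equation (with $t=t_2$) is equivalent to the local lattice equation \[ u_{,t_2}=u(v_3-v_2+v_1-v_{-1}+v_{-2}-v_{-3}-u_2+u_{-2}),\qquad v=u_1uu_{-1} . \]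
   Context: Here $u=u(n,t)$ and $f=f(n,t)$ are functions of $n\in\mathbb Z$ and $t$; subscripts denote shifts, $u_j=u(n+j,t)$ (similarly for $f$, $v$), and $u_{,t}=\partial_tu$. $T$ is the shift operator $n\mapsto n+1$. Difference operators are Laurent polynomials in $T$ whose coefficients are functions of $n$ and $t$, multiplied by the rule $T\,a=T(a)\,T$. The conjugation $\dagger$ is the anti-automorphism with $T^\dagger=T^{-1}$ and $a^\dagger=a$ for functions $a$. The $t$-derivative of an operator is taken coefficientwise, so $K_{,t}=u_{,t}T^3$. In (1) the variable $f$ is an additional unknown constrained by the second equation. The operator equation is a Lax-type equation for $L=K^{-1}K^\dagger$, associated with the spectral problem $K^\dagger\psi=\lambda K\psi$. *)

theory Defs
  imports "HOL-Analysis.Analysis" "HOL-Library.Function_Algebras"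
begin

text \<open>
  A difference operator is a Laurent polynomial \<open>\<Sum>\<^sub>k c\<^sub>k T\<^sup>k\<close> in the shift \<open>T\<close>. Its coefficients are
  functions of \<open>n :: int\<close> with values in a commutative ring \<open>'c\<close>; functions of \<open>n\<close> and \<open>t\<close> are
  obtained with \<open>'c = real \<Rightarrow> 'a\<close>, a ring under the pointwise operations.
\<close>

typedef (overloaded) 'c diff_op = "{c :: int \<Rightarrow> int \<Rightarrow> 'c::comm_ring_1. finite {k. c k \<noteq> 0}}"
  morphisms coef Diff_Op
  by (rule exI[of _ 0]) simp

setup_lifting type_definition_diff_op

definition shift :: "int \<Rightarrow> (int \<Rightarrow> 'c) \<Rightarrow> int \<Rightarrow> 'c"
  where "shift j a = (\<lambda>n. a (n + j))"

abbreviation supp :: "'c::comm_ring_1 diff_op \<Rightarrow> int set"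
  where "supp P \<equiv> {k. coef P k \<noteq> 0}"

lemma finite_supp [simp]: "finite (supp P)"
  using coef[of P] by simp

lemma diff_op_eqI: "(\<And>k n. coef P k n = coef Q k n) \<Longrightarrow> P = Q"
  by (simp add: coef_inject[symmetric] fun_eq_iff)

lift_definition fn_op :: "(int \<Rightarrow> 'c::comm_ring_1) \<Rightarrow> 'c diff_op"
  is "\<lambda>a k. if k = 0 then a else 0"
  by (rule finite_subset[of _ "{0}"]) auto

lift_definition T_pow :: "int \<Rightarrow> 'c::comm_ring_1 diff_op"
  is "\<lambda>j k. if k = j then 1 else 0"
  subgoal for j by (rule finite_subset[of _ "{j}"]) auto
  done

text \<open>
  The product is determined by \<open>(a T\<^sup>k) (b T\<^sup>j) = a T\<^sup>k(b) T\<^sup>k\<^sup>+\<^sup>j\<close>.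
\<close>

instantiation diff_op :: (comm_ring_1) ring_1
begin

lift_definition zero_diff_op :: "'a diff_op" is 0
  by simp

lift_definition one_diff_op :: "'a diff_op" is "\<lambda>k. if k = 0 then 1 else 0"
  by (rule finite_subset[of _ "{0}"]) auto

lift_definition plus_diff_op :: "'a diff_op \<Rightarrow> 'a diff_op \<Rightarrow> 'a diff_op"
  is "\<lambda>p q k. p k + q k"
  subgoal for p q
    by (rule finite_subset[of _ "{k. p k \<noteq> 0} \<union> {k. q k \<noteq> 0}"]) auto
  done

lift_definition uminus_diff_op :: "'a diff_op \<Rightarrow> 'a diff_op" is "\<lambda>p k. - p k"
  by simp

lift_definition minus_diff_op :: "'a diff_op \<Rightarrow> 'a diff_op \<Rightarrow> 'a diff_op"
  is "\<lambda>p q k. p k - q k"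
  subgoal for p q
    by (rule finite_subset[of _ "{k. p k \<noteq> 0} \<union> {k. q k \<noteq> 0}"]) auto
  done

lift_definition times_diff_op :: "'a diff_op \<Rightarrow> 'a diff_op \<Rightarrow> 'a diff_op"
  is "\<lambda>p q m. \<Sum>k | p k \<noteq> 0. p k * shift k (q (m - k))"
  subgoal premises prems for p q
  proof (rule finite_subset)
    show "finite ((\<lambda>(i, j). i + j) ` ({k. p k \<noteq> 0} \<times> {k. q k \<noteq> 0}))"
      using prems by auto
    show "{m. (\<Sum>k | p k \<noteq> 0. p k * shift k (q (m - k))) \<noteq> 0}
      \<subseteq> (\<lambda>(i, j). i + j) ` ({k. p k \<noteq> 0} \<times> {k. q k \<noteq> 0})"
    proof
      fix m assume "m \<in> {m. (\<Sum>k | p k \<noteq> 0. p k * shift k (q (m - k))) \<noteq> 0}"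
      then obtain k where k: "p k \<noteq> 0" "p k * shift k (q (m - k)) \<noteq> 0"
        using sum.not_neutral_contains_not_neutral by fastforce
      have "q (m - k) \<noteq> 0"
      proof
        assume "q (m - k) = 0"
        then have "p k * shift k (q (m - k)) = 0" by (simp add: fun_eq_iff shift_def)
        with k show False by simp
      qed
      with k show "m \<in> (\<lambda>(i, j). i + j) ` ({k. p k \<noteq> 0} \<times> {k. q k \<noteq> 0})"
        by (intro image_eqI[of _ _ "(k, m - k)"]) auto
    qed
  qed
  done

lemma sum_fun_apply: "(\<Sum>k\<in>A. f k) n = (\<Sum>k\<in>A. (f k n :: 'b::comm_monoid_add))"
  by (induction A rule: infinite_finite_induct) auto

text \<open>The ring axioms follow from the faithful action of difference operators on sequences.\<close>

definition act :: "'a::comm_ring_1 diff_op \<Rightarrow> (int \<Rightarrow> 'a) \<Rightarrow> int \<Rightarrow> 'a"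
  where "act P x n = (\<Sum>k\<in>supp P. coef P k n * x (n + k))"

lemma act_superset:
  assumes "finite A" "supp P \<subseteq> A"
  shows "act P x n = (\<Sum>k\<in>A. coef P k n * x (n + k))"
  unfolding act_def by (rule sum.mono_neutral_left) (use assms in auto)

lemma act_faithful:
  assumes "\<And>x n. act P x n = act Q x n"
  shows "P = Q"
proof (rule diff_op_eqI)
  fix k n
  have *: "act R (\<lambda>i. if i = n + k then 1 else 0) n = coef R k n" for R :: "'a diff_op"
  proof -
    have "act R (\<lambda>i. if i = n + k then 1 else 0) n
      = (\<Sum>j\<in>insert k (supp R). coef R j n * (if n + j = n + k then 1 else 0))"
      by (rule act_superset) auto
    also have "\<dots> = (\<Sum>j\<in>insert k (supp R). if j = k then coef R j n else 0)"
      by (intro sum.cong) auto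
    finally show ?thesis by simp
  qed
  show "coef P k n = coef Q k n"
    using assms[of "\<lambda>i. if i = n + k then 1 else 0" n] by (simp add: *)
qed

lemma act_times: "act (P * Q) x n = act P (act Q x) n"
proof -
  define M where "M = (\<lambda>(i, j). i + j) ` (supp P \<times> supp Q)"
  have fM: "finite M" unfolding M_def by simp
  have coef_PQ: "coef (P * Q) m n = (\<Sum>k\<in>supp P. coef P k n * coef Q (m - k) (n + k))" for m n
    by (simp add: times_diff_op.rep_eq sum_fun_apply shift_def)
  have sub: "supp (P * Q) \<subseteq> M"
  proof
    fix m assume "m \<in> supp (P * Q)"
    then obtain n where "coef (P * Q) m n \<noteq> 0" by (auto simp: fun_eq_iff)
    then obtain k where k: "k \<in> supp P" "coef P k n * coef Q (m - k) (n + k) \<noteq> 0"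
      unfolding coef_PQ by (rule sum.not_neutral_contains_not_neutral)
    then have "coef Q (m - k) \<noteq> 0" by auto
    with k show "m \<in> M" unfolding M_def by (intro image_eqI[of _ _ "(k, m - k)"]) auto
  qed
  have "act (P * Q) x n = (\<Sum>m\<in>M. coef (P * Q) m n * x (n + m))"
    by (rule act_superset[OF fM sub])
  also have "\<dots> = (\<Sum>k\<in>supp P. \<Sum>m\<in>M. coef P k n * coef Q (m - k) (n + k) * x (n + m))"
    unfolding coef_PQ sum_distrib_right by (rule sum.swap)
  also have "\<dots> = (\<Sum>k\<in>supp P. coef P k n * act Q x (n + k))"
  proof (rule sum.cong[OF refl])
    fix k assume k: "k \<in> supp P"
    have "(\<Sum>m\<in>M. coef P k n * coef Q (m - k) (n + k) * x (n + m))
      = (\<Sum>m\<in>(\<lambda>j. k + j) ` supp Q. coef P k n * coef Q (m - k) (n + k) * x (n + m))"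
    proof (rule sum.mono_neutral_right[OF fM])
      show "(\<lambda>j. k + j) ` supp Q \<subseteq> M" using k unfolding M_def by auto
      show "\<forall>m\<in>M - (\<lambda>j. k + j) ` supp Q. coef P k n * coef Q (m - k) (n + k) * x (n + m) = 0"
      proof
        fix m assume m: "m \<in> M - (\<lambda>j. k + j) ` supp Q"
        have "coef Q (m - k) = 0"
        proof (rule ccontr)
          assume "coef Q (m - k) \<noteq> 0"
          then have "m \<in> (\<lambda>j. k + j) ` supp Q" by (intro image_eqI[of _ _ "m - k"]) auto
          with m show False by simp
        qed
        then show "coef P k n * coef Q (m - k) (n + k) * x (n + m) = 0" by simp
      qed
    qed
    also have "\<dots> = (\<Sum>j\<in>supp Q. coef P k n * coef Q j (n + k) * x (n + (k + j)))"
      by (subst sum.reindex) (auto simp: inj_on_def)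
    also have "\<dots> = coef P k n * act Q x (n + k)"
      by (simp add: act_def sum_distrib_left mult.assoc add.assoc)
    finally show "(\<Sum>m\<in>M. coef P k n * coef Q (m - k) (n + k) * x (n + m))
      = coef P k n * act Q x (n + k)" .
  qed
  also have "\<dots> = act P (act Q x) n" by (simp add: act_def)
  finally show ?thesis .
qed

lemma act_plus: "act (P + Q) x n = act P x n + act Q x n"
proof -
  let ?A = "supp P \<union> supp Q"
  have "act (P + Q) x n = (\<Sum>k\<in>?A. coef (P + Q) k n * x (n + k))"
    by (rule act_superset) (auto simp: plus_diff_op.rep_eq)
  moreover have "act P x n = (\<Sum>k\<in>?A. coef P k n * x (n + k))"
    by (rule act_superset) auto
  moreover have "act Q x n = (\<Sum>k\<in>?A. coef Q k n * x (n + k))"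
    by (rule act_superset) auto
  moreover have "coef (P + Q) k n * x (n + k) = coef P k n * x (n + k) + coef Q k n * x (n + k)" for k
    by (simp add: plus_diff_op.rep_eq distrib_right)
  ultimately show ?thesis
    by (simp only: sum.distrib)
qed

lemma act_add_right: "act P (\<lambda>n. x n + y n) n = act P x n + act P y n"
  by (simp add: act_def sum.distrib distrib_left)

lemma act_one: "act 1 x n = x n"
  by (subst act_superset[of "{0}"]) (auto simp: one_diff_op.rep_eq)

instance
proof
  fix P Q R :: "'a diff_op"
  show "P * Q * R = P * (Q * R)"
  proof (rule act_faithful)
    fix x n
    have "act (Q * R) x = act Q (act R x)" by (rule ext) (rule act_times)
    then show "act (P * Q * R) x n = act (P * (Q * R)) x n" by (simp add: act_times)
  qed
  show "1 * P = P" by (rule act_faithful) (simp add: act_times act_one)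
  show "P * 1 = P"
  proof (rule act_faithful)
    fix x n
    have "act 1 x = x" by (rule ext) (rule act_one)
    then show "act (P * 1) x n = act P x n" by (simp add: act_times)
  qed
  show "(P + Q) * R = P * R + Q * R"
    by (rule act_faithful) (simp add: act_times act_plus)
  show "P * (Q + R) = P * Q + P * R"
  proof (rule act_faithful)
    fix x n
    have "act (Q + R) x = (\<lambda>n. act Q x n + act R x n)" by (rule ext) (rule act_plus)
    then show "act (P * (Q + R)) x n = act (P * Q + P * R) x n"
      by (simp add: act_times act_plus act_add_right)
  qed
  show "(0::'a diff_op) \<noteq> 1"
  proof
    assume "(0::'a diff_op) = 1"
    then have "coef (0::'a diff_op) 0 0 = coef 1 0 0" by simp
    then show False by (simp add: zero_diff_op.rep_eq one_diff_op.rep_eq)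
  qed
qed (transfer, simp add: fun_eq_iff)+

end

lemma act_fn_op: "act (fn_op a) x n = a n * x n"
  by (subst act_superset[of "{0}"]) (auto simp: fn_op.rep_eq)

lemma act_T_pow: "act (T_pow k) x n = x (n + k)"
  by (subst act_superset[of "{k}"]) (auto simp: T_pow.rep_eq)

lemma T_pow_0: "T_pow 0 = 1"
  by (rule act_faithful) (simp add: act_T_pow act_one)

lemma T_pow_mult: "T_pow j * T_pow k = T_pow (j + k)"
  by (rule act_faithful) (simp add: act_times act_T_pow add.assoc)

lemma fn_op_mult: "fn_op a * fn_op b = fn_op (a * b)"
  by (rule act_faithful) (simp add: act_times act_fn_op mult.assoc)

lemma T_pow_fn_op: "T_pow k * fn_op a = fn_op (shift k a) * T_pow k"
  by (rule act_faithful) (simp add: act_times act_fn_op act_T_pow shift_def)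

lemma coef_monomial: "coef (fn_op a * T_pow j) k = (if k = j then a else 0)"
proof -
  have "fn_op a * T_pow j = Diff_Op (\<lambda>k. if k = j then a else 0)" (is "_ = ?R")
  proof (rule act_faithful)
    have "finite {k. (if k = j then a else 0) \<noteq> 0}"
      by (rule finite_subset[of _ "{j}"]) auto
    then have c: "coef ?R = (\<lambda>k. if k = j then a else 0)"
      by (subst Diff_Op_inverse) auto
    fix x n
    show "act (fn_op a * T_pow j) x n = act ?R x n"
      by (subst act_superset[of "{j}" ?R]) (auto simp: c act_times act_fn_op act_T_pow)
  qed
  moreover have "finite {k. (if k = j then a else 0) \<noteq> 0}"
    by (rule finite_subset[of _ "{j}"]) auto
  ultimately show ?thesis by (simp add: Diff_Op_inverse)
qed

text \<open>
  Conjugation: \<open>(c T\<^sup>k)\<^sup>\<dagger> = T\<^sup>-\<^sup>k c\<close>, whose coefficient is \<open>T\<^sup>-\<^sup>k(c)\<close>.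
\<close>

lift_definition dagger :: "'c::comm_ring_1 diff_op \<Rightarrow> 'c diff_op"
  is "\<lambda>p k. shift k (p (- k))"
  subgoal premises prems for p
  proof (rule finite_subset)
    show "finite (uminus ` {k. p k \<noteq> 0})" using prems by simp
    show "{k. shift k (p (- k)) \<noteq> 0} \<subseteq> uminus ` {k. p k \<noteq> 0}"
    proof
      fix k assume "k \<in> {k. shift k (p (- k)) \<noteq> 0}"
      then have "p (- k) \<noteq> 0" by (auto simp: shift_def fun_eq_iff)
      then show "k \<in> uminus ` {k. p k \<noteq> 0}" by (intro image_eqI[of _ _ "- k"]) auto
    qed
  qed
  done

lemma dagger_T_pow: "dagger (T_pow k) = T_pow (- k)"
  by (rule diff_op_eqI) (auto simp: dagger.rep_eq T_pow.rep_eq shift_def)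

lemma dagger_fn_op: "dagger (fn_op a) = fn_op a"
  by (rule diff_op_eqI) (auto simp: dagger.rep_eq fn_op.rep_eq shift_def)

lemma dagger_dagger: "dagger (dagger P) = P"
  by (rule diff_op_eqI) (simp add: dagger.rep_eq shift_def)

lemma dagger_add: "dagger (P + Q) = dagger P + dagger Q"
  by (rule diff_op_eqI) (simp add: dagger.rep_eq plus_diff_op.rep_eq shift_def)

lemma dagger_mult: "dagger (P * Q) = dagger Q * dagger P"
proof (rule diff_op_eqI)
  fix m n
  have supp_dagger: "supp (dagger Q) = uminus ` supp Q"
  proof (intro set_eqI iffI)
    fix k assume "k \<in> supp (dagger Q)"
    then have "coef Q (- k) \<noteq> 0" by (auto simp: dagger.rep_eq shift_def fun_eq_iff)
    then show "k \<in> uminus ` supp Q" by (intro image_eqI[of _ _ "- k"]) auto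
  next
    fix k assume "k \<in> uminus ` supp Q"
    then have "coef Q (- k) \<noteq> 0" by auto
    then obtain i where "coef Q (- k) i \<noteq> 0" by (auto simp: fun_eq_iff)
    then have "coef (dagger Q) k (i - k) \<noteq> 0" by (simp add: dagger.rep_eq shift_def)
    then show "k \<in> supp (dagger Q)" by auto
  qed
  let ?g = "\<lambda>k. coef P k (n + m) * coef Q (- m - k) (n + m + k)"
  let ?h = "\<lambda>j. - m - j"
  have "coef (dagger (P * Q)) m n = (\<Sum>k\<in>supp P. ?g k)"
    by (simp add: dagger.rep_eq times_diff_op.rep_eq sum_fun_apply shift_def)
  also have "\<dots> = (\<Sum>k\<in>supp P \<union> ?h ` supp Q. ?g k)"
    by (rule sum.mono_neutral_left) auto
  also have "\<dots> = (\<Sum>k\<in>?h ` supp Q. ?g k)"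
  proof (rule sum.mono_neutral_right)
    show "\<forall>k\<in>supp P \<union> ?h ` supp Q - ?h ` supp Q. ?g k = 0"
    proof
      fix k assume k: "k \<in> supp P \<union> ?h ` supp Q - ?h ` supp Q"
      have "coef Q (- m - k) = 0"
      proof (rule ccontr)
        assume "coef Q (- m - k) \<noteq> 0"
        then have "k \<in> ?h ` supp Q" by (intro image_eqI[of _ _ "- m - k"]) auto
        with k show False by simp
      qed
      then show "?g k = 0" by simp
    qed
  qed auto
  also have "\<dots> = (\<Sum>j\<in>supp Q. coef P (- m - j) (n + m) * coef Q j (n - j))"
    by (subst sum.reindex) (auto simp: inj_on_def)
  also have "\<dots> = (\<Sum>k\<in>supp (dagger Q). coef (dagger Q) k n * coef (dagger P) (m - k) (n + k))"
    unfolding supp_dagger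
    by (subst sum.reindex) (auto simp: inj_on_def dagger.rep_eq shift_def mult.commute minus_diff_commute intro!: sum.cong)
  also have "\<dots> = coef (dagger Q * dagger P) m n"
    by (simp add: times_diff_op.rep_eq sum_fun_apply shift_def)
  finally show "coef (dagger (P * Q)) m n = coef (dagger Q * dagger P) m n" .
qed

type_synonym 'a lattice_fn = "int \<Rightarrow> real \<Rightarrow> 'a"

definition dt :: "'a::real_normed_field lattice_fn \<Rightarrow> 'a lattice_fn"
  where "dt a = (\<lambda>n t. vector_derivative (a n) (at t))"

lift_definition op_dt :: "(real \<Rightarrow> 'a::real_normed_field) diff_op \<Rightarrow> (real \<Rightarrow> 'a) diff_op"
  is "\<lambda>p k. dt (p k)"
  subgoal premises prems for p
  proof (rule finite_subset[OF _ prems])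
    have "dt (0 :: 'a lattice_fn) = 0"
      by (simp add: dt_def fun_eq_iff zero_fun_def)
    then show "{k. dt (p k) \<noteq> 0} \<subseteq> {k. p k \<noteq> 0}" by auto
  qed
  done

lift_definition op_at :: "(real \<Rightarrow> 'a::comm_ring_1) diff_op \<Rightarrow> real \<Rightarrow> 'a diff_op"
  is "\<lambda>p t k n. p k n t"
  subgoal premises prems for p
    by (rule finite_subset[OF _ prems]) (auto simp: fun_eq_iff)
  done

text \<open>The time domain is a set \<open>S\<close>, so that solutions need not exist for all times.\<close>

definition operator_equation ::
    "real set \<Rightarrow> (real \<Rightarrow> 'a::real_normed_field) diff_op \<Rightarrow> (real \<Rightarrow> 'a) diff_op \<Rightarrow> bool"
  where "operator_equation S K A \<longleftrightarrow>
    (\<forall>t\<in>S. op_at (op_dt K + dagger A * K + K * A) t = 0)"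

definition K_op :: "'a::real_normed_field lattice_fn \<Rightarrow> (real \<Rightarrow> 'a) diff_op"
  where "K_op u = fn_op u * T_pow 3 + T_pow 1"

lemma op_dt_K_op: "op_dt (K_op u) = fn_op (dt u) * T_pow 3"
proof (rule diff_op_eqI)
  fix k n
  have one: "coef (T_pow 1 :: (real \<Rightarrow> 'a) diff_op) k n = (\<lambda>t. if k = 1 then 1 else 0)"
    by (auto simp: T_pow.rep_eq fun_eq_iff)
  have c: "coef (K_op u) k n = (if k = 3 then u n else if k = 1 then (\<lambda>t. 1) else (\<lambda>t. 0))"
    unfolding K_op_def plus_diff_op.rep_eq coef_monomial
    by (auto simp: one fun_eq_iff)
  show "coef (op_dt (K_op u)) k n = coef (fn_op (dt u) * T_pow 3) k n"
    unfolding op_dt.rep_eq dt_def c coef_monomial by (auto simp: fun_eq_iff)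
qed

definition A_nonlocal ::
    "'a::real_normed_field lattice_fn \<Rightarrow> 'a lattice_fn \<Rightarrow> (real \<Rightarrow> 'a) diff_op"
  where "A_nonlocal u f =
    - fn_op f * T_pow 2
    + fn_op (shift (-2) f * shift (-2) u - shift (-1) f * shift (-1) u)
    + fn_op (shift (-3) f) * T_pow (-2)"

definition A_local ::
    "'a::real_normed_field lattice_fn \<Rightarrow> 'a lattice_fn \<Rightarrow> (real \<Rightarrow> 'a) diff_op"
  where "A_local u v =
    fn_op (shift 1 u) * T_pow 4 - fn_op (shift (-4) u) * T_pow (-4)
    + fn_op (1 - shift (-1) u * shift (-2) u) * (T_pow 2 - T_pow (-2))
    + fn_op (shift (-1) u - shift (-2) u - v + shift (-1) v - shift (-2) v + shift (-3) v)"

end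

theory Submission
  imports Defs
begin

text \<open>
  The operator equation is compared coefficientwise in the powers of \<open>T\<close>. For \<open>A_nonlocal\<close> the
  coefficient of \<open>T\<^sup>3\<close> is the evolution equation, that of \<open>T\<^sup>5\<close> is the constraint on \<open>f\<close>, and those of
  \<open>T\<close> and \<open>T\<^sup>-\<^sup>1\<close> cancel identically. For \<open>A_local\<close> the coefficients of \<open>T\<^sup>7\<close>, \<open>T\<^sup>5\<close>, \<open>T\<close>, \<open>T\<^sup>-\<^sup>1\<close> and
  \<open>T\<^sup>-\<^sup>3\<close> cancel identically and only the evolution equation at \<open>T\<^sup>3\<close> remains; the cancellation at \<open>T\<close>
  uses \<open>v = u\<^sub>1 u u\<^sub>-\<^sub>1\<close>.
\<close>

text \<open>Summands outside the support vanish, so any finite superset can index the product. Thus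
  \<open>{0}\<close> works for \<open>fn_op a\<close> even where \<open>a = 0\<close> empties the
  support.\<close>

lemma coef_mult_superset:
  assumes "finite B" "supp P \<subseteq> B"
  shows "coef (P * Q) m n = (\<Sum>k\<in>B. coef P k n * coef Q (m - k) (n + k))"
proof -
  have "coef (P * Q) m n = (\<Sum>k\<in>supp P. coef P k n * coef Q (m - k) (n + k))"
    by (simp add: times_diff_op.rep_eq sum_fun_apply shift_def)
  also have "\<dots> = (\<Sum>k\<in>B. coef P k n * coef Q (m - k) (n + k))"
    by (rule sum.mono_neutral_left) (use assms in auto)
  finally show ?thesis .
qed

lemma coef_fn_op_mult: "coef (fn_op a * P) k n = a n * coef P k n"
  by (subst coef_mult_superset[of "{0}"]) (auto simp: fn_op.rep_eq)

lemma coef_T_pow_mult: "coef (T_pow j * P) k n = coef P (k - j) (n + j)"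
  by (subst coef_mult_superset[of "{j}"]) (auto simp: T_pow.rep_eq)

lemma coef_mult_fn_op: "coef (P * fn_op a) k n = coef P k n * a (n + k)"
  \<comment> \<open>Inserting \<open>k\<close> keeps the only contributing index in the sum, even
    when \<open>coef P k = 0\<close>.\<close>
  by (subst coef_mult_superset[of "insert k (supp P)"])
     (auto simp: fn_op.rep_eq if_distribR if_distrib[of "\<lambda>x. _ * x"] cong: if_cong)

lemma coef_mult_T_pow: "coef (P * T_pow j) k n = coef P (k - j) n"
proof -
  have "coef (P * T_pow j) k n
      = (\<Sum>i\<in>insert (k - j) (supp P). if i = k - j then coef P i n else 0)"
    unfolding coef_mult_superset[OF finite.insertI[OF finite_supp] subset_insertI[of "supp P" "k - j"]]
    by (rule sum.cong) (auto simp: T_pow.rep_eq)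
  then show ?thesis by simp
qed

text \<open>Each product with the two-term \<open>K_op u\<close> gives two terms. \<open>A\<close>
  stays arbitrary, so both choices of \<open>A\<close> reduce to reading off its coefficients. The
  derivative enters only at \<open>m = 3\<close>, since the coefficient of \<open>T\<close> in
  \<open>K_op u\<close> is constant.\<close>

lemma coef_operator_equation:
  "coef (op_dt (K_op u) + dagger A * K_op u + K_op u * A) m n t =
    (if m = 3 then dt u n t else 0)
    + coef A (3 - m) (n + m - 3) t * u (n + m - 3) t + coef A (1 - m) (n + m - 1) t
    + u n t * coef A (m - 3) (n + 3) t + coef A (m - 1) (n + 1) t"
proof -
  have "dagger A * K_op u = dagger A * fn_op u * T_pow 3 + dagger A * T_pow 1"
    by (simp add: K_op_def distrib_left mult.assoc)
  then have "coef (dagger A * K_op u) m n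
      = coef A (3 - m) (n + m - 3) * u (n + m - 3) + coef A (1 - m) (n + m - 1)"
    by (simp add: plus_diff_op.rep_eq coef_mult_T_pow coef_mult_fn_op dagger.rep_eq shift_def
        add_diff_eq)
  moreover have "coef (K_op u * A) m n = u n * coef A (m - 3) (n + 3) + coef A (m - 1) (n + 1)"
    by (simp add: K_op_def distrib_right mult.assoc plus_diff_op.rep_eq coef_fn_op_mult
        coef_T_pow_mult)
  moreover have "coef (op_dt (K_op u)) m n t = (if m = 3 then dt u n t else 0)"
    by (simp add: op_dt_K_op coef_monomial)
  ultimately show ?thesis
    by (simp add: plus_diff_op.rep_eq)
qed

lemma operator_equation_iff_coef:
  "operator_equation S K A \<longleftrightarrow>
    (\<forall>t\<in>S. \<forall>m n. coef (op_dt K + dagger A * K + K * A) m n t = 0)"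
  by (simp add: operator_equation_def coef_inject[symmetric] fun_eq_iff op_at.rep_eq
      zero_diff_op.rep_eq)

lemma coef_A_nonlocal:
  "coef (A_nonlocal u f) k n t =
    (if k = 2 then - f n t
     else if k = 0 then f (n - 2) t * u (n - 2) t - f (n - 1) t * u (n - 1) t
     else if k = - 2 then f (n - 3) t else 0)"
  by (simp add: A_nonlocal_def plus_diff_op.rep_eq minus_diff_op.rep_eq uminus_diff_op.rep_eq
      coef_fn_op_mult
      fn_op.rep_eq T_pow.rep_eq shift_def)

lemma coef_A_local:
  "coef (A_local u v) k n t =
    (if k = 4 then u (n + 1) t
     else if k = - 4 then - u (n - 4) t
     else if k = 2 then 1 - u (n - 1) t * u (n - 2) t
     else if k = - 2 then - (1 - u (n - 1) t * u (n - 2) t)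
     else if k = 0 then u (n - 1) t - u (n - 2) t
       - v n t + v (n - 1) t - v (n - 2) t + v (n - 3) t
     else 0)"
  by (simp add: A_local_def plus_diff_op.rep_eq minus_diff_op.rep_eq coef_fn_op_mult
      fn_op.rep_eq T_pow.rep_eq shift_def)

lemma operator_equation_nonlocal:
  "operator_equation S (K_op u) (A_nonlocal u f) \<longleftrightarrow>
    (\<forall>n. \<forall>t\<in>S.
      dt u n t =
        u n t * (f (n+2) t * u (n+2) t - f (n+1) t * u (n+1) t
                 + f (n-1) t * u (n-1) t - f (n-2) t * u (n-2) t)
        + f (n+1) t - f (n-1) t
      \<and> f (n+3) t * u n t = f (n-1) t * u (n+2) t)"
  (is "_ \<longleftrightarrow> (\<forall>n. \<forall>t\<in>S. ?D n t \<and> ?C n t)")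
proof -
  let ?A = "A_nonlocal u f"
  define E where "E = coef (op_dt (K_op u) + dagger ?A * K_op u + K_op u * ?A)"
  note E_coef = coef_operator_equation[of u ?A, folded E_def]
  have D: "E 3 n t = 0 \<longleftrightarrow> ?D n t" for n t
    \<comment> \<open>Moving everything to one side gives both equations the form
      \<open>_ = 0\<close>, which \<open>algebra_simps\<close> can then match.\<close>
    unfolding eq_iff_diff_eq_0[of "dt u n t"]
    by (simp add: E_coef coef_A_nonlocal algebra_simps)
  have C: "E 5 n t = 0 \<longleftrightarrow> ?C n t" for n t
    by (auto simp: E_coef coef_A_nonlocal algebra_simps)
  have zero: "E m n t = 0" if m: "m \<noteq> 3" "m \<noteq> 5" for m n t
  proof -
    \<comment> \<open>In the last case \<open>3 - m\<close>, \<open>1 - m\<close>,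
      \<open>m - 3\<close> and \<open>m - 1\<close> all avoid \<open>-2\<close>, \<open>0\<close>
      and \<open>2\<close>, the only possible powers in \<open>?A\<close>.\<close>
    consider "m = 1" | "m = - 1" | "m \<notin> {- 1, 1, 3, 5}" using m by blast
    then show ?thesis
      by cases (simp_all add: E_coef coef_A_nonlocal algebra_simps)
  qed
  have "(\<forall>m n. E m n t = 0) \<longleftrightarrow> (\<forall>n. E 3 n t = 0 \<and> E 5 n t = 0)" for t
    using zero by metis
  then show ?thesis
    unfolding operator_equation_iff_coef E_def[symmetric] by (simp only: D C) blast
qed

lemma operator_equation_local:
  assumes v: "v = (\<lambda>n t. u (n+1) t * u n t * u (n-1) t)"
  shows "operator_equation S (K_op u) (A_local u v) \<longleftrightarrow>
    (\<forall>n. \<forall>t\<in>S.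
      dt u n t =
        u n t * (v (n+3) t - v (n+2) t + v (n+1) t - v (n-1) t + v (n-2) t - v (n-3) t
                 - u (n+2) t + u (n-2) t))"
  (is "_ \<longleftrightarrow> (\<forall>n. \<forall>t\<in>S. ?D n t)")
proof -
  let ?A = "A_local u v"
  define E where "E = coef (op_dt (K_op u) + dagger ?A * K_op u + K_op u * ?A)"
  note E_coef = coef_operator_equation[of u ?A, folded E_def]
  \<comment> \<open>\<open>v\<close> stays opaque here: its unshifted copies cancel, and the
    quadratic terms from the coefficients of order 2 and -2 cancel against those of order 0.\<close>
  have D: "E 3 n t = 0 \<longleftrightarrow> ?D n t" for n t
    unfolding eq_iff_diff_eq_0[of "dt u n t"]
    by (simp add: E_coef coef_A_local algebra_simps)
  have zero: "E m n t = 0" if m: "m \<noteq> 3" for m n t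
  proof -
    consider "m = 7" | "m = 5" | "m = 1" | "m = - 1" | "m = - 3" | "m \<notin> {- 3, - 1, 1, 3, 5, 7}"
      using m by blast
    then show ?thesis
      \<comment> \<open>At \<open>m = 1\<close> the \<open>v\<close> terms telescope to
        \<open>v (n-3) t - v (n+1) t\<close>; expanding \<open>v\<close> cancels them against the
        cubic terms from the coefficients of order 2 and -2.\<close>
      by cases (simp_all add: E_coef coef_A_local v algebra_simps)
  qed
  have "(\<forall>m n. E m n t = 0) \<longleftrightarrow> (\<forall>n. E 3 n t = 0)" for t
    using zero by metis
  then show ?thesis
    unfolding operator_equation_iff_coef E_def[symmetric] by (simp only: D) blast
qed

theorem theorem6:
  fixes u f v :: "int \<Rightarrow> real \<Rightarrow> 'a::real_normed_field" and S :: "real set"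
  assumes "open S"
    and "\<And>n t. t \<in> S \<Longrightarrow> u n differentiable (at t)"
  shows "(operator_equation S (K_op u) (A_nonlocal u f) \<longleftrightarrow>
      (\<forall>n. \<forall>t\<in>S.
        dt u n t =
          u n t * (f (n+2) t * u (n+2) t - f (n+1) t * u (n+1) t
                   + f (n-1) t * u (n-1) t - f (n-2) t * u (n-2) t)
          + f (n+1) t - f (n-1) t
        \<and> f (n+3) t * u n t = f (n-1) t * u (n+2) t))
    \<and>
    (v = (\<lambda>n t. u (n+1) t * u n t * u (n-1) t) \<longrightarrow>
      (operator_equation S (K_op u) (A_local u v) \<longleftrightarrow>
      (\<forall>n. \<forall>t\<in>S.
        dt u n t =
          u n t * (v (n+3) t - v (n+2) t + v (n+1) t - v (n-1) t + v (n-2) t - v (n-3) t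
                   - u (n+2) t + u (n-2) t))))"
  by (intro conjI impI operator_equation_nonlocal operator_equation_local)

end
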